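(* Let $T=[a_1,b_1]\times\cdots\times[a_n,b_n]\subset\mathbb R^n$ be a closed brick. (a) A function $f:T\to\mathbb R$ is K-integrable if and only if the following two conditions are satisfied: (1) $f$ is bounded outside some Jordan null set; (2) the set $\mathrm{dis}_2(f)$ of discontinuity points of the second kind of $f$ is a Jordan null set. (b) Moreover, if $f:T\to\mathbb R$ is K-integrable, then the set of discontinuities of $f$ may be covered by a Jordan null set and countably many hyperplanes whose normal vectors are parallel to some of the coordinate axes (i.e. hyperplanes of the form $\{x\in\mathbb R^n: x_j=c\}$ with $1\le j\le n$, $c\in\mathbb R$); in particular, a K-integrable function is continuous Lebesgue almost everywhere.
   Context: Fix a positive integer $n$. A brick is a product $I_1\times\cdots\times I_n$ of $n$ bounded (nonempty) intervals (open, closed or half-open, possibly degenerate); its volume $\lambda$ is the product of the lengths of the intervals. A step function on $T$ is a finite linear combination $g=\sum_{j=1}^M c_j\chi_{T_j}$ of characteristic functions of bricks $T_j\subset T$; its integral is $\int_T g=\sum_j c_j\lambda(T_j)$. A sequence of functions $f_m:T\to\mathbb R$ converges nearly uniformly to $f:T\to\mathbb R$ if (i) the sequence $(f_m)$ is uniformly bounded on $T$, and (ii) for every $\delta>0$ there exist finitely many bricks contained in $T$, of total volume less than $\delta$, such that $f_m$ converges uniformly to $f$ on the complement (in $T$) of their union. A function $f:T\to\mathbb R$ is K-integrable if there is a sequence $(g_m)$ of step functions converging nearly uniformly to $f$; its K-integral is then $\int_T f:=\lim_{m\to\infty}\int_T g_m$ (the limit exists and does not depend on the choice of $(g_m)$).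 A set is a Jordan null set if for each $\varepsilon>0$ it can be covered by finitely many bricks of total volume less than $\varepsilon$. Directional limits: for $x\in\mathrm{int}(T)$ and a nonzero vector ("direction") $\alpha\in\{-1,0,1\}^n$, let $T_{x,\alpha}=I_1\times\cdots\times I_n$ where $I_k=[a_k,x_k)$ if $\alpha_k=-1$, $I_k=\{x_k\}$ if $\alpha_k=0$, and $I_k=(x_k,b_k]$ if $\alpha_k=1$. If the restriction $f|_{T_{x,\alpha}}$ has a limit $L$ at $x$, then $f$ has the limit $\lim_{x,\alpha}f=L$ at $x$ in the direction $\alpha$. A point $x\in\mathrm{int}(T)$ at which $f$ is not continuous is a discontinuity point of the first kind if $f$ has a finite limit at $x$ in every direction $\alpha\in\{-1,0,1\}^n\setminus\{0\}$; otherwise it is a discontinuity point of the second kind. $\mathrm{dis}_2(f)$ denotes the set of discontinuity points of the second kind (a subset of $\mathrm{int}(T)$). *)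

theory Defs
  imports "HOL-Analysis.Analysis"
begin

text \<open>A function on \<open>T\<close> is represented by a total function on \<^typ>\<open>real ^ 'n\<close>; all notions below
  depend only on its values on \<open>T\<close>.\<close>

text \<open>On the reals, \<^const>\<open>is_interval\<close> (order-convexity) together with boundedness and nonemptiness
  gives exactly the bounded open, closed, half-open and degenerate intervals.\<close>

definition brick :: "(real ^ 'n) set \<Rightarrow> bool" where
  "brick B \<longleftrightarrow> (\<exists>I :: 'n \<Rightarrow> real set.
      (\<forall>k. is_interval (I k) \<and> bounded (I k) \<and> I k \<noteq> {}) \<and> B = {x. \<forall>k. x $ k \<in> I k})"

text \<open>The factors of a brick are recovered as its coordinate projections (they are nonempty);
  see \<open>brick_volume_product\<close> below.\<close>

definition brick_volume :: "(real ^ 'n) set \<Rightarrow> real" where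
  "brick_volume B = (\<Prod>k\<in>UNIV. Sup ((\<lambda>x. x $ k) ` B) - Inf ((\<lambda>x. x $ k) ` B))"

lemma brick_volume_product:
  fixes I :: "'n::finite \<Rightarrow> real set"
  assumes "\<And>k. I k \<noteq> {}"
  shows "brick_volume {x. \<forall>k. x $ k \<in> I k} = (\<Prod>k\<in>UNIV. Sup (I k) - Inf (I k))"
proof -
  have "(\<lambda>x. x $ k) ` {x :: real ^ 'n. \<forall>k. x $ k \<in> I k} = I k" for k
  proof (intro equalityI subsetI)
    fix t assume t: "t \<in> I k"
    define p where "p = (\<lambda>j. SOME t. t \<in> I j)"
    have p: "p j \<in> I j" for j unfolding p_def by (rule some_in_eq[THEN iffD2, OF assms])
    have "(\<chi> j. (p(k := t)) j) \<in> {x :: real ^ 'n. \<forall>k. x $ k \<in> I k}" using p t by auto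
    moreover have "t = (\<chi> j. (p(k := t)) j) $ k" by simp
    ultimately show "t \<in> (\<lambda>x. x $ k) ` {x :: real ^ 'n. \<forall>k. x $ k \<in> I k}" by blast
  qed auto
  then show ?thesis by (simp add: brick_volume_def)
qed

definition step_function_on :: "(real ^ 'n) set \<Rightarrow> (real ^ 'n \<Rightarrow> real) \<Rightarrow> bool" where
  "step_function_on T g \<longleftrightarrow> (\<exists>(M::nat) (c :: nat \<Rightarrow> real) (B :: nat \<Rightarrow> (real ^ 'n) set).
      (\<forall>j<M. brick (B j) \<and> B j \<subseteq> T) \<and> (\<forall>x\<in>T. g x = (\<Sum>j<M. c j * indicator (B j) x)))"

definition converges_nearly_uniformly ::
  "(real ^ 'n) set \<Rightarrow> (nat \<Rightarrow> real ^ 'n \<Rightarrow> real) \<Rightarrow> (real ^ 'n \<Rightarrow> real) \<Rightarrow> bool" where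
  "converges_nearly_uniformly T F f \<longleftrightarrow>
      (\<exists>C. \<forall>m. \<forall>x\<in>T. \<bar>F m x\<bar> \<le> C) \<and>
      (\<forall>\<delta>>0. \<exists>\<B>. finite \<B> \<and> (\<forall>B\<in>\<B>. brick B \<and> B \<subseteq> T) \<and> (\<Sum>B\<in>\<B>. brick_volume B) < \<delta> \<and>
          uniform_limit (T - \<Union>\<B>) F f sequentially)"

definition K_integrable_on :: "(real ^ 'n \<Rightarrow> real) \<Rightarrow> (real ^ 'n) set \<Rightarrow> bool" where
  "K_integrable_on f T \<longleftrightarrow>
      (\<exists>g. (\<forall>m. step_function_on T (g m)) \<and> converges_nearly_uniformly T g f)"

definition jordan_null :: "(real ^ 'n) set \<Rightarrow> bool" where
  "jordan_null S \<longleftrightarrow>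
      (\<forall>\<epsilon>>0. \<exists>\<B>. finite \<B> \<and> (\<forall>B\<in>\<B>. brick B) \<and> S \<subseteq> \<Union>\<B> \<and> (\<Sum>B\<in>\<B>. brick_volume B) < \<epsilon>)"

definition directions :: "(int ^ 'n) set" where
  "directions = {\<alpha>. (\<forall>k. \<alpha> $ k \<in> {-1, 0, 1}) \<and> \<alpha> \<noteq> 0}"

definition directional_part :: "real ^ 'n \<Rightarrow> real ^ 'n \<Rightarrow> real ^ 'n \<Rightarrow> int ^ 'n \<Rightarrow> (real ^ 'n) set" where
  "directional_part a b x \<alpha> =
      {y. \<forall>k. y $ k \<in> (if \<alpha> $ k = -1 then {a $ k..<x $ k}
                        else if \<alpha> $ k = 0 then {x $ k}
                        else {x $ k<..b $ k})}"

definition discontinuities_on :: "(real ^ 'n \<Rightarrow> real) \<Rightarrow> (real ^ 'n) set \<Rightarrow> (real ^ 'n) set" where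
  "discontinuities_on f T = {x \<in> T. \<not> continuous (at x within T) f}"

definition dis1 :: "real ^ 'n \<Rightarrow> real ^ 'n \<Rightarrow> (real ^ 'n \<Rightarrow> real) \<Rightarrow> (real ^ 'n) set" where
  "dis1 a b f = {x \<in> interior (cbox a b) \<inter> discontinuities_on f (cbox a b).
      \<forall>\<alpha>\<in>directions. \<exists>L::real. (f \<longlongrightarrow> L) (at x within directional_part a b x \<alpha>)}"

definition dis2 :: "real ^ 'n \<Rightarrow> real ^ 'n \<Rightarrow> (real ^ 'n \<Rightarrow> real) \<Rightarrow> (real ^ 'n) set" where
  "dis2 a b f = (interior (cbox a b) \<inter> discontinuities_on f (cbox a b)) - dis1 a b f"

definition coordinate_hyperplane :: "(real ^ 'n) set \<Rightarrow> bool" where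
  "coordinate_hyperplane H \<longleftrightarrow> (\<exists>j c. H = {x. x $ j = c})"

end

theory Submission
  imports Defs
begin

text \<open>
  If \<open>f\<close> is a nearly uniform limit of step functions, then off a closed finite union of bricks of
  arbitrarily small volume \<open>f\<close> is locally a uniform limit of step functions. Step functions have all
  directional limits and are continuous off finitely many coordinate hyperplanes; both properties
  pass to uniform limits (the second with countably many hyperplanes).

  Conversely, let \<open>W\<close> be an open neighbourhood of the exceptional set, of small volume. Around each
  point of the compact set \<open>T - W\<close>, the parts \<open>T\<^bsub>x,\<alpha>\<^esub>\<close> and \<open>{x}\<close> cut a small box into bricks on
  which \<open>f\<close> oscillates little, so by compactness finitely many bricks yield a step function close
  to \<open>f\<close> on \<open>T - W\<close>. Letting \<open>W\<close> shrink along a decreasing sequence gives nearly uniform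
  convergence.
\<close>

section \<open>Bricks and their volume\<close>

lemma brickE:
  fixes B :: "(real ^ 'n) set"
  assumes "brick B"
  obtains I where "\<And>k. is_interval (I k)" "\<And>k. bounded (I k)" "\<And>k. I k \<noteq> {}"
    "B = {x. \<forall>k. x $ k \<in> I k}"
proof -
  obtain I :: "'n \<Rightarrow> real set" where "(\<forall>k. is_interval (I k) \<and> bounded (I k) \<and> I k \<noteq> {}) \<and> B = {x. \<forall>k. x $ k \<in> I k}"
    using assms unfolding brick_def ..
  then show thesis by (intro that[of I]) simp_all
qed

lemma brick_cbox:
  fixes l u :: "real ^ 'n"
  assumes "\<And>k. l $ k \<le> u $ k"
  shows "brick (cbox l u)" "brick_volume (cbox l u) = (\<Prod>k\<in>UNIV. u $ k - l $ k)"
proof -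
  have eq: "cbox l u = {x. \<forall>k. x $ k \<in> {l $ k..u $ k}}"
    by (auto simp: mem_box_cart)
  show "brick (cbox l u)"
    unfolding brick_def eq using assms by (intro exI[of _ "\<lambda>k. {l $ k..u $ k}"]) (auto simp: is_interval_cc)
  show "brick_volume (cbox l u) = (\<Prod>k\<in>UNIV. u $ k - l $ k)"
    unfolding eq using assms by (subst brick_volume_product) auto
qed

lemma brick_box:
  fixes l u :: "real ^ 'n"
  assumes "\<And>k. l $ k < u $ k"
  shows "brick (box l u)" "brick_volume (box l u) = (\<Prod>k\<in>UNIV. u $ k - l $ k)"
proof -
  have eq: "box l u = {x. \<forall>k. x $ k \<in> {l $ k<..<u $ k}}"
    by (auto simp: mem_box_cart)
  have ne: "{l $ k<..<u $ k} \<noteq> {}" for k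
    using assms[of k] by simp
  show "brick (box l u)"
    unfolding brick_def eq using ne
    by (intro exI[of _ "\<lambda>k. {l $ k<..<u $ k}"]) (simp add: is_interval_oo)
  show "brick_volume (box l u) = (\<Prod>k\<in>UNIV. u $ k - l $ k)"
    unfolding eq brick_volume_product[OF ne] using assms by simp
qed

text \<open>A factor \<open>I k\<close> contains every point strictly between its infimum and its
  supremum, since it has members on both sides of such a point and is order-convex. Taking these
  bounds as corners reduces bricks with mixed end points to open and closed boxes; if a factor is
  degenerate, \<open>box l u\<close> is empty.\<close>

lemma brick_between_boxes:
  fixes B :: "(real ^ 'n) set"
  assumes "brick B"
  obtains l u where "\<And>k. l $ k \<le> u $ k" "box l u \<subseteq> B" "B \<subseteq> cbox l u"
    "brick_volume B = (\<Prod>k\<in>UNIV. u $ k - l $ k)"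
proof -
  obtain I where I: "\<And>k. is_interval (I k)" "\<And>k. bounded (I k)" "\<And>k. I k \<noteq> {}"
    and B: "B = {x. \<forall>k. x $ k \<in> I k}"
    using assms by (rule brickE) (rule that; assumption)
  have bdd: "bdd_above (I k)" "bdd_below (I k)" for k
    using I(2) by (auto simp: bounded_imp_bdd_above bounded_imp_bdd_below)
  define l u :: "real ^ 'n" where "l = (\<chi> k. Inf (I k))" and "u = (\<chi> k. Sup (I k))"
  have mem: "t \<in> I k" if "Inf (I k) < t" "t < Sup (I k)" for t k
  proof -
    obtain p q where "p \<in> I k" "p < t" "q \<in> I k" "t < q"
      using \<open>Inf (I k) < t\<close> \<open>t < Sup (I k)\<close> cInf_less_iff[OF I(3) bdd(2)] less_cSup_iff[OF I(3) bdd(1)] by blast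
    then show ?thesis using I(1)[of k] unfolding is_interval_1 by (meson less_imp_le)
  qed
  show thesis
  proof
    show "l $ k \<le> u $ k" for k
      using I(3) bdd by (simp add: l_def u_def cInf_le_cSup)
    show "box l u \<subseteq> B"
      using mem by (auto simp: B l_def u_def mem_box_cart)
    show "B \<subseteq> cbox l u"
      using bdd by (auto simp: B l_def u_def mem_box_cart cInf_lower cSup_upper)
    show "brick_volume B = (\<Prod>k\<in>UNIV. u $ k - l $ k)"
      using I(3) by (simp add: B brick_volume_product l_def u_def)
  qed
qed

lemma brick_nonempty: "brick B \<Longrightarrow> B \<noteq> {}"
proof -
  assume "brick B"
  then obtain I where I: "\<And>k. I k \<noteq> {}" and B: "B = {x. \<forall>k. x $ k \<in> I k}"
    by (rule brickE) (rule that; assumption)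
  have "(\<chi> k. SOME t. t \<in> I k) \<in> B"
    using I by (simp add: B some_in_eq)
  then show ?thesis by blast
qed

lemma bounded_brick: "brick B \<Longrightarrow> bounded B"
  by (metis brick_between_boxes bounded_cbox bounded_subset)

lemma brick_volume_nonneg: "brick B \<Longrightarrow> 0 \<le> brick_volume B"
proof (erule brick_between_boxes)
  fix l u assume "\<And>k. l $ k \<le> u $ k" "brick_volume B = (\<Prod>k\<in>UNIV. u $ k - l $ k)"
  then show "0 \<le> brick_volume B" by (simp add: prod_nonneg)
qed

lemma brick_volume_mono:
  fixes B B' :: "(real ^ 'n) set"
  assumes "brick B" "brick B'" "B \<subseteq> B'"
  shows "brick_volume B \<le> brick_volume B'"
proof -
  have ne: "(\<lambda>x. x $ k) ` B \<noteq> {}" for k using brick_nonempty[OF assms(1)] by auto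
  have bd: "bounded ((\<lambda>x. x $ k) ` B')" for k
    using bounded_brick[OF assms(2)] by (rule bounded_component_cart)
  then have bd': "bdd_above ((\<lambda>x. x $ k) ` B')" "bdd_below ((\<lambda>x. x $ k) ` B')"
       "bdd_above ((\<lambda>x. x $ k) ` B)" "bdd_below ((\<lambda>x. x $ k) ` B)" for k
    using assms(3) by (meson bounded_imp_bdd_above bounded_imp_bdd_below bdd_above_mono bdd_below_mono image_mono)+
  have sub: "(\<lambda>x. x $ k) ` B \<subseteq> (\<lambda>x. x $ k) ` B'" for k using assms(3) by blast
  show ?thesis
    unfolding brick_volume_def
    using cSup_subset_mono[OF ne bd'(1) sub] cInf_superset_mono[OF ne bd'(2) sub]
      cInf_le_cSup[OF ne bd'(3,4)]
    by (intro prod_mono conjI) (auto intro: diff_mono)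
qed

text \<open>Factors are intersected coordinatewise. Since a brick has nonempty factors, disjoint
  bricks must be excluded here and treated separately by every caller.\<close>

lemma brick_Int:
  assumes "brick B" "brick B'" "B \<inter> B' \<noteq> {}"
  shows "brick (B \<inter> B')"
proof -
  obtain I where I: "\<And>k. is_interval (I k)" "\<And>k. bounded (I k)"
    and B: "B = {x. \<forall>k. x $ k \<in> I k}"
    using assms(1) by (rule brickE) (rule that; assumption)
  obtain I' where I': "\<And>k. is_interval (I' k)" and B': "B' = {x. \<forall>k. x $ k \<in> I' k}"
    using assms(2) by (rule brickE) (rule that; assumption)
  have "B \<inter> B' = {x. \<forall>k. x $ k \<in> I k \<inter> I' k}" unfolding B B' by auto
  moreover have "I k \<inter> I' k \<noteq> {}" for k
    using assms(3) unfolding B B' by blast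
  ultimately show ?thesis
    unfolding brick_def using I I' by (intro exI[of _ "\<lambda>k. I k \<inter> I' k"]) (simp add: is_interval_Int bounded_Int)
qed

text \<open>The volume of the enclosing box depends continuously on the amount \<open>t\<close> by
  which each side is pushed outwards, so a small \<open>t > 0\<close> costs less than
  \<open>e\<close>. Any such \<open>t\<close> also opens up degenerate sides.\<close>

lemma brick_enlarge:
  fixes B :: "(real ^ 'n) set"
  assumes "brick B" "0 < e"
  obtains U where "brick U" "open U" "B \<subseteq> U" "brick_volume U < brick_volume B + e"
proof -
  obtain l u where lu: "\<And>k. l $ k \<le> u $ k" "B \<subseteq> cbox l u"
    and vol: "brick_volume B = (\<Prod>k\<in>UNIV. u $ k - l $ k)"
    using brick_between_boxes[OF assms(1)] by metis
  have "((\<lambda>t. \<Prod>k\<in>UNIV. (u $ k + t) - (l $ k - t)) \<longlongrightarrow> (\<Prod>k\<in>UNIV. (u $ k + 0) - (l $ k - 0))) (at_right (0::real))"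
    by (intro tendsto_intros)
  then have "\<forall>\<^sub>F t in at_right 0. (\<Prod>k\<in>UNIV. (u $ k + t) - (l $ k - t)) < brick_volume B + e"
    using assms(2) by (intro order_tendstoD(2)) (auto simp: vol)
  then have "\<forall>\<^sub>F t in at_right 0. (\<Prod>k\<in>UNIV. (u $ k + t) - (l $ k - t)) < brick_volume B + e \<and> 0 < t"
    by (intro eventually_conj eventually_at_right_less)
  then obtain t :: real where t: "0 < t" "(\<Prod>k\<in>UNIV. (u $ k + t) - (l $ k - t)) < brick_volume B + e"
    using eventually_happens'[OF trivial_limit_at_right_real] by blast
  define l' u' where "l' = (\<chi> k. l $ k - t)" and "u' = (\<chi> k. u $ k + t)"
  have less: "l' $ k < u' $ k" for k using lu(1)[of k] t(1) by (simp add: l'_def u'_def)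
  show thesis
  proof (rule that)
    show "brick (box l' u')" using less by (rule brick_box)
    show "open (box l' u')" by (rule open_box)
    have "cbox l u \<subseteq> box l' u'"
      using t(1) by (auto simp: mem_box_cart l'_def u'_def intro: add_strict_increasing2 less_le_trans le_less_trans)
        (smt (verit))+
    then show "B \<subseteq> box l' u'" using lu(2) by blast
    show "brick_volume (box l' u') < brick_volume B + e"
      using t(2) brick_box(2)[OF less] by (simp add: l'_def u'_def)
  qed
qed

section \<open>Covers by bricks and Jordan null sets\<close>

text \<open>Bookkeeping for replacing each brick of a cover by \<open>h B\<close>: if
  \<open>h\<close> identifies some bricks, the sum over the image only drops, because volumes are
  nonnegative. It serves for enlarging bricks, for closing them and for cutting them down to
  \<open>T\<close>; the last two take \<open>e = 0\<close>.\<close>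

lemma sum_brick_volume_image_le:
  fixes h :: "(real ^ 'n) set \<Rightarrow> (real ^ 'n) set" and e :: real
  assumes "finite \<B>" "\<And>B. B \<in> \<B> \<Longrightarrow> brick (h B)" 
    "\<And>B. B \<in> \<B> \<Longrightarrow> brick_volume (h B) \<le> brick_volume B + e"
  shows "(\<Sum>B\<in>h ` \<B>. brick_volume B) \<le> (\<Sum>B\<in>\<B>. brick_volume B) + card \<B> * e"
proof -
  have "(\<Sum>B\<in>h ` \<B>. brick_volume B) \<le> (\<Sum>B\<in>\<B>. brick_volume (h B))"
    using assms(1,2) sum_image_le[of \<B> brick_volume h] brick_volume_nonneg by (auto simp: o_def)
  also have "\<dots> \<le> (\<Sum>B\<in>\<B>. brick_volume B + e)"
    using assms by (intro sum_mono) auto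
  finally show ?thesis by (simp add: sum.distrib)
qed

lemma jordan_nullE:
  assumes "jordan_null S" "0 < e"
  obtains \<B> where "finite \<B>" "\<forall>B\<in>\<B>. brick B" "S \<subseteq> \<Union>\<B>" "(\<Sum>B\<in>\<B>. brick_volume B) < e"
proof -
  obtain \<B> where "finite \<B> \<and> (\<forall>B\<in>\<B>. brick B) \<and> S \<subseteq> \<Union>\<B> \<and> (\<Sum>B\<in>\<B>. brick_volume B) < e"
    using assms(1)[unfolded jordan_null_def, rule_format, OF assms(2)] by (rule exE)
  then show thesis by (intro that[of \<B>]) simp_all
qed

text \<open>Half of \<open>e\<close> pays for the given cover and the other half for enlarging its
  bricks to open ones. Openness later makes the uncovered part of the closed box compact.\<close>

lemma jordan_null_open_cover:
  assumes "jordan_null S" "0 < e"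
  obtains \<U> where "finite \<U>" "\<And>U. U \<in> \<U> \<Longrightarrow> brick U \<and> open U" "S \<subseteq> \<Union>\<U>"
    "(\<Sum>U\<in>\<U>. brick_volume U) < e"
proof -
  obtain \<B> where \<B>: "finite \<B>" "\<forall>B\<in>\<B>. brick B" "S \<subseteq> \<Union>\<B>" "(\<Sum>B\<in>\<B>. brick_volume B) < e / 2"
    using assms(1) half_gt_zero[OF assms(2)] by (rule jordan_nullE)
  \<comment> \<open>Adding 1 keeps the denominator positive for an empty cover;
    \<open>card \<B>\<close> enlargements still cost at most \<open>e / 2\<close>.\<close>
  define d where "d = e / (2 * (card \<B> + 1))"
  have d: "0 < d" using assms(2) by (simp add: d_def)
  have "\<exists>U. brick U \<and> open U \<and> B \<subseteq> U \<and> brick_volume U \<le> brick_volume B + d" if "B \<in> \<B>" for B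
    using brick_enlarge[OF \<B>(2)[rule_format, OF that] d] by (metis less_imp_le)
  then obtain h where h: "\<And>B. B \<in> \<B> \<Longrightarrow> brick (h B) \<and> open (h B) \<and> B \<subseteq> h B \<and> brick_volume (h B) \<le> brick_volume B + d"
    by metis
  show thesis
  proof (rule that)
    show "finite (h ` \<B>)" using \<B>(1) by simp
    show "brick U \<and> open U" if "U \<in> h ` \<B>" for U using that h by blast
    show "S \<subseteq> \<Union>(h ` \<B>)" using \<B>(3) h by blast
    have "(\<Sum>U\<in>h ` \<B>. brick_volume U) \<le> (\<Sum>B\<in>\<B>. brick_volume B) + card \<B> * d"
      by (rule sum_brick_volume_image_le) (use \<B>(1) h in auto)
    also have "card \<B> * d \<le> e / 2"
      using assms(2) by (simp add: d_def field_simps)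
    finally show "(\<Sum>U\<in>h ` \<B>. brick_volume U) < e" using \<B>(4) by simp
  qed
qed

lemma jordan_null_subset: "jordan_null S \<Longrightarrow> S' \<subseteq> S \<Longrightarrow> jordan_null S'"
  unfolding jordan_null_def by (meson order_trans)

lemma jordan_null_Un:
  assumes "jordan_null S" "jordan_null S'"
  shows "jordan_null (S \<union> S')"
  unfolding jordan_null_def
proof (intro allI impI)
  fix e :: real assume "0 < e"
  then have e: "0 < e / 2" by simp
  obtain \<B> where \<B>: "finite \<B>" "\<forall>B\<in>\<B>. brick B" "S \<subseteq> \<Union>\<B>" "(\<Sum>B\<in>\<B>. brick_volume B) < e / 2"
    using assms(1) e by (rule jordan_nullE)
  obtain \<B>' where \<B>': "finite \<B>'" "\<forall>B\<in>\<B>'. brick B" "S' \<subseteq> \<Union>\<B>'" "(\<Sum>B\<in>\<B>'. brick_volume B) < e / 2"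
    using assms(2) e by (rule jordan_nullE)
  have "(\<Sum>B\<in>\<B> \<union> \<B>'. brick_volume B) \<le> (\<Sum>B\<in>\<B>. brick_volume B) + (\<Sum>B\<in>\<B>'. brick_volume B)"
    using \<B> \<B>' by (subst sum.union_inter[symmetric]) (auto intro!: sum_nonneg brick_volume_nonneg)
  then show "\<exists>\<B>. finite \<B> \<and> (\<forall>B\<in>\<B>. brick B) \<and> S \<union> S' \<subseteq> \<Union>\<B> \<and> (\<Sum>B\<in>\<B>. brick_volume B) < e"
    using \<B> \<B>' by (intro exI[of _ "\<B> \<union> \<B>'"]) (auto simp: Un_subset_iff le_supI1)
qed

lemma jordan_null_Union:
  assumes "finite \<S>" "\<And>S. S \<in> \<S> \<Longrightarrow> jordan_null S"
  shows "jordan_null (\<Union>\<S>)"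
  using assms
proof (induction)
  case empty
  show ?case unfolding jordan_null_def by (auto intro!: exI[of _ "{}"])
qed (auto intro: jordan_null_Un)

text \<open>Open covering bricks are Lebesgue measurable, and comparison with an enclosing closed
  box bounds their measure by \<open>brick_volume\<close>.\<close>

lemma jordan_null_imp_negligible:
  assumes "jordan_null S"
  shows "negligible S"
  unfolding negligible_outer
proof (intro allI impI)
  fix e :: real assume "0 < e"
  obtain \<U> where \<U>: "finite \<U>" "\<And>U. U \<in> \<U> \<Longrightarrow> brick U \<and> open U" "S \<subseteq> \<Union>\<U>"
    "(\<Sum>U\<in>\<U>. brick_volume U) < e"
    using jordan_null_open_cover[OF assms \<open>0 < e\<close>] by metis
  have m: "U \<in> lmeasurable" "measure lebesgue U \<le> brick_volume U" if "U \<in> \<U>" for U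
  proof -
    have U: "brick U" "open U" using \<U>(2) that by auto
    then show "U \<in> lmeasurable" using bounded_brick lmeasurable_open by blast
    moreover obtain l u where lu: "\<And>k. l $ k \<le> u $ k" "U \<subseteq> cbox l u" "brick_volume U = (\<Prod>k\<in>UNIV. u $ k - l $ k)"
      using brick_between_boxes[OF U(1)] by metis
    ultimately have "measure lebesgue U \<le> measure lebesgue (cbox l u)"
      by (intro measure_mono_fmeasurable) auto
    also have "\<dots> = brick_volume U"
      using lu content_cbox_cart[of l u] by (simp add: interval_eq_empty_cart not_less)
    finally show "measure lebesgue U \<le> brick_volume U" .
  qed
  have "measure lebesgue (\<Union>\<U>) \<le> (\<Sum>U\<in>\<U>. measure lebesgue U)"
    using \<U>(1) m(1) by (intro measure_Union_le) auto
  also have "\<dots> \<le> (\<Sum>U\<in>\<U>. brick_volume U)" using m(2) by (rule sum_mono)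
  also note \<U>(4)
  finally show "\<exists>T. S \<subseteq> T \<and> T \<in> lmeasurable \<and> measure lebesgue T < e"
    using \<U>(1,3) m(1) by (intro exI[of _ "\<Union>\<U>"]) (auto intro: fmeasurable.finite_Union)
qed

text \<open>Each face is a closed box degenerate in one coordinate, hence of volume zero. The
  boundary has to be dealt with separately because \<open>dis2\<close> contains interior points
  only.\<close>

lemma jordan_null_boundary_cbox:
  fixes a b :: "real ^ 'n"
  assumes "\<And>k. a $ k \<le> b $ k"
  shows "jordan_null (cbox a b - interior (cbox a b))"
proof -
  have face: "jordan_null {x \<in> cbox a b. x $ k = c}" if c: "a $ k \<le> c" "c \<le> b $ k" for k c
  proof -
    define l u where "l = (\<chi> j. if j = k then c else a $ j)" and "u = (\<chi> j. if j = k then c else b $ j)"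
    have lu: "l $ j \<le> u $ j" for j using assms by (simp add: l_def u_def)
    have "brick_volume (cbox l u) = 0"
      unfolding brick_cbox(2)[OF lu] by (rule prod_zero) (auto intro!: bexI[of _ k] simp: l_def u_def)
    moreover have "{x \<in> cbox a b. x $ k = c} \<subseteq> cbox l u"
      by (auto simp: mem_box_cart l_def u_def)
    ultimately show ?thesis
      unfolding jordan_null_def using brick_cbox(1)[OF lu] by (auto intro!: exI[of _ "{cbox l u}"])
  qed
  have "cbox a b - interior (cbox a b) \<subseteq> \<Union>((\<lambda>k. {x \<in> cbox a b. x $ k = a $ k} \<union> {x \<in> cbox a b. x $ k = b $ k}) ` UNIV)"
    by (auto simp: interior_cbox mem_box_cart order_less_le) metis+
  moreover have "jordan_null \<dots>"
    using assms face by (intro jordan_null_Union) (auto intro!: jordan_null_Un)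
  ultimately show ?thesis by (rule jordan_null_subset[rotated])
qed

section \<open>Step functions and their arithmetic\<close>

lemma step_function_onE:
  fixes T :: "(real ^ 'n) set"
  assumes "step_function_on T g"
  obtains M :: nat and c B where "\<forall>j<M. brick (B j) \<and> B j \<subseteq> T"
    "\<forall>x\<in>T. g x = (\<Sum>j<M. c j * indicator (B j) x)"
proof -
  obtain M :: nat and c :: "nat \<Rightarrow> real" and B :: "nat \<Rightarrow> (real ^ 'n) set"
    where "(\<forall>j<M. brick (B j) \<and> B j \<subseteq> T) \<and> (\<forall>x\<in>T. g x = (\<Sum>j<M. c j * indicator (B j) x))"
    using assms unfolding step_function_on_def by (elim exE)
  then show thesis by (intro that[of M B c]) simp_all
qed

lemma step_function_on_cong:
  "step_function_on T g \<Longrightarrow> (\<And>x. x \<in> T \<Longrightarrow> g x = h x) \<Longrightarrow> step_function_on T h"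
  unfolding step_function_on_def by metis

lemma step_function_on_zero: "step_function_on T (\<lambda>_. 0)"
  unfolding step_function_on_def by (rule exI[of _ 0]) auto

lemma step_function_on_indicator:
  "brick B \<Longrightarrow> B \<subseteq> T \<Longrightarrow> step_function_on T (\<lambda>x. c * indicator B x)"
  unfolding step_function_on_def
  by (rule exI[of _ 1], rule exI[of _ "\<lambda>_. c"], rule exI[of _ "\<lambda>_. B"]) auto

lemma step_function_on_add:
  assumes "step_function_on T g" "step_function_on T h"
  shows "step_function_on T (\<lambda>x. g x + h x)"
proof -
  obtain M :: nat and c B where g: "\<forall>j<M. brick (B j) \<and> B j \<subseteq> T"
    "\<forall>x\<in>T. g x = (\<Sum>j<M. c j * indicator (B j) x)"
    using assms(1) by (rule step_function_onE) (rule that; assumption)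
  obtain M' :: nat and c' B' where h: "\<forall>j<M'. brick (B' j) \<and> B' j \<subseteq> T"
    "\<forall>x\<in>T. h x = (\<Sum>j<M'. c' j * indicator (B' j) x)"
    using assms(2) by (rule step_function_onE) (rule that; assumption)
  \<comment> \<open>The two families are concatenated, the second one shifted by
    \<open>M\<close>.\<close>
  define d where "d j = (if j < M then c j else c' (j - M))" for j
  define D where "D j = (if j < M then B j else B' (j - M))" for j
  have "(\<Sum>j<M + M'. d j * indicator (D j) x) = g x + h x" if "x \<in> T" for x
  proof -
    have "(\<Sum>j<M + M'. d j * indicator (D j) x) = (\<Sum>j<M. d j * indicator (D j) x) + (\<Sum>j=M..<M+M'. d j * indicator (D j) x)"
      unfolding lessThan_atLeast0 by (rule sum.atLeastLessThan_concat[symmetric]) auto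
    also have "(\<Sum>j=M..<M+M'. d j * indicator (D j) x) = (\<Sum>j<M'. d (j + M) * indicator (D (j + M)) x)"
      using sum.shift_bounds_nat_ivl[of "\<lambda>j. d j * indicator (D j) x" 0 M M']
      by (simp add: lessThan_atLeast0 add.commute)
    finally show ?thesis using that g(2) h(2) by (simp add: d_def D_def)
  qed
  moreover have "\<forall>j<M + M'. brick (D j) \<and> D j \<subseteq> T" using g(1) h(1) by (auto simp: D_def)
  ultimately show ?thesis
    unfolding step_function_on_def by (intro exI[of _ "M + M'"] exI[of _ d] exI[of _ D]) simp
qed

lemma step_function_on_sum:
  "(\<And>j. j < (M::nat) \<Longrightarrow> step_function_on T (h j)) \<Longrightarrow> step_function_on T (\<lambda>x. \<Sum>j<M. h j x)"
  by (induction M) (auto intro: step_function_on_zero step_function_on_add)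

text \<open>Each brick of \<open>g\<close> is intersected with \<open>P\<close>; an empty
  intersection is no brick, but its term is the zero function. The factor \<open>c\<close> is there
  so that \<open>g\<close> can be cancelled on \<open>P\<close> by taking
  \<open>c = -1\<close>.\<close>

lemma step_function_on_mult_indicator:
  assumes "step_function_on T g" "brick P"
  shows "step_function_on T (\<lambda>x. c * (g x * indicator P x))"
proof -
  obtain M :: nat and d B where g: "\<forall>j<M. brick (B j) \<and> B j \<subseteq> T"
    "\<forall>x\<in>T. g x = (\<Sum>j<M. d j * indicator (B j) x)"
    using assms(1) by (rule step_function_onE) (rule that; assumption)
  have "step_function_on T (\<lambda>x. (c * d j) * indicator (B j \<inter> P) x)" if "j < M" for j
  proof (cases "B j \<inter> P = {}")
    case True
    then show ?thesis by (simp add: step_function_on_zero)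
  next
    case False
    then show ?thesis using that g(1) assms(2) by (intro step_function_on_indicator brick_Int) auto
  qed
  then have "step_function_on T (\<lambda>x. \<Sum>j<M. (c * d j) * indicator (B j \<inter> P) x)"
    by (rule step_function_on_sum)
  moreover have "(\<Sum>j<M. (c * d j) * indicator (B j \<inter> P) x) = c * (g x * indicator P x)" if "x \<in> T" for x
    by (simp only: g(2)[rule_format, OF that] sum_distrib_left sum_distrib_right indicator_inter_arith mult_ac)
  ultimately show ?thesis by (rule step_function_on_cong)
qed

text \<open>The pieces may overlap. Each inserted piece overwrites the old values on it instead of
  adding to them, so every covered point carries the value of some piece containing it and the bound
  \<open>C\<close> survives.\<close>

lemma step_function_on_pieces:
  fixes T :: "(real ^ 'n) set" and v :: "(real ^ 'n) set \<Rightarrow> real"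
  assumes "finite \<P>" "\<And>P. P \<in> \<P> \<Longrightarrow> brick P \<and> P \<subseteq> T" "\<And>P. P \<in> \<P> \<Longrightarrow> \<bar>v P\<bar> \<le> C" "0 \<le> C"
  shows "\<exists>g. step_function_on T g \<and> (\<forall>x\<in>T. \<bar>g x\<bar> \<le> C) \<and> (\<forall>x\<in>\<Union>\<P>. \<exists>P\<in>\<P>. x \<in> P \<and> g x = v P)"
  using assms
proof (induction)
  case empty
  then show ?case by (auto intro!: exI[of _ "\<lambda>_. 0"] step_function_on_zero)
next
  case (insert P \<P>)
  then obtain g where g: "step_function_on T g" "\<forall>x\<in>T. \<bar>g x\<bar> \<le> C" "\<forall>x\<in>\<Union>\<P>. \<exists>P\<in>\<P>. x \<in> P \<and> g x = v P"
    by auto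
  define h where "h x = g x + (-1) * (g x * indicator P x) + v P * indicator P x" for x
  have "step_function_on T h"
    unfolding h_def using insert.prems(1) g(1)
    by (intro step_function_on_add step_function_on_mult_indicator step_function_on_indicator) auto
  moreover have "h x = (if x \<in> P then v P else g x)" for x by (simp add: h_def)
  ultimately show ?case using g(2,3) insert.prems by (intro exI[of _ h] conjI) (assumption, auto)
qed

section \<open>Directions and directional parts of a box\<close>

lemma finite_directions: "finite (directions :: (int ^ 'n) set)"
proof -
  have "(directions :: (int ^ 'n) set) \<subseteq> vec_lambda ` (PiE UNIV (\<lambda>_. {-1, 0, 1}))"
  proof
    fix \<alpha> :: "int ^ 'n" assume "\<alpha> \<in> directions"
    then have "(\<lambda>k. \<alpha> $ k) \<in> PiE UNIV (\<lambda>_. {-1, 0, 1})" by (auto simp: directions_def)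
    then show "\<alpha> \<in> vec_lambda ` (PiE UNIV (\<lambda>_. {-1, 0, 1}))"
      by (metis image_eqI vec_nth_inverse)
  qed
  then show ?thesis by (rule finite_subset) (intro finite_imageI finite_PiE, auto)
qed

lemma directional_part_subset:
  fixes x :: "real ^ 'n"
  assumes "x \<in> cbox a b"
  shows "directional_part a b x \<alpha> \<subseteq> cbox a b"
proof
  fix y assume y: "y \<in> directional_part a b x \<alpha>"
  have "a $ k \<le> y $ k \<and> y $ k \<le> b $ k" for k
    using y[unfolded directional_part_def, simplified, rule_format, of k] assms[unfolded mem_box_cart, rule_format, of k]
    by (auto split: if_splits)
  then show "y \<in> cbox a b" by (simp add: mem_box_cart)
qed

lemma center_notin_directional_part:
  "\<alpha> \<in> directions \<Longrightarrow> x \<notin> directional_part a b x \<alpha>"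
  unfolding directions_def directional_part_def vec_eq_iff
  by (force split: if_splits)

lemma brick_directional_part:
  fixes x :: "real ^ 'n"
  assumes "x \<in> box a b"
  shows "brick (directional_part a b x \<alpha>)"
  unfolding brick_def directional_part_def
  using assms
  by (intro exI[of _ "\<lambda>k. if \<alpha> $ k = -1 then {a $ k..<x $ k} else if \<alpha> $ k = 0 then {x $ k} else {x $ k<..b $ k}"])
    (auto simp: mem_box_cart is_interval_1)

text \<open>The direction is the vector of signs of the coordinates of \<open>y - x\<close>, nonzero
  because the points differ.\<close>

lemma cbox_directional_parts:
  fixes x :: "real ^ 'n"
  assumes "x \<in> cbox a b" "y \<in> cbox a b" "y \<noteq> x"
  obtains \<alpha> where "\<alpha> \<in> directions" "y \<in> directional_part a b x \<alpha>"
proof -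
  define \<alpha> :: "int ^ 'n" where "\<alpha> = (\<chi> k. if y $ k < x $ k then -1 else if y $ k = x $ k then 0 else 1)"
  obtain k where "y $ k \<noteq> x $ k" using assms(3) by (auto simp: vec_eq_iff)
  then have "\<alpha> $ k \<noteq> 0" by (simp add: \<alpha>_def)
  then have "\<alpha> \<noteq> 0" by auto
  then have "\<alpha> \<in> directions" unfolding directions_def by (auto simp: \<alpha>_def)
  moreover have "y \<in> directional_part a b x \<alpha>"
    using assms(1,2) by (auto simp: directional_part_def \<alpha>_def mem_box_cart)
  ultimately show thesis by (rule that)
qed

text \<open>A point outside \<open>dis2\<close> is either of the first kind or a point of
  continuity, where the full limit restricts to each part. This gives one property for both
  cases.\<close>

lemma directional_limit_exists:
  fixes x :: "real ^ 'n"
  assumes "x \<in> interior (cbox a b)" "x \<notin> dis2 a b f" "\<alpha> \<in> directions"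
  shows "\<exists>L. (f \<longlongrightarrow> L) (at x within directional_part a b x \<alpha>)"
proof (cases "x \<in> discontinuities_on f (cbox a b)")
  case True
  then show ?thesis using assms unfolding dis2_def dis1_def by blast
next
  case False
  have x: "x \<in> cbox a b" using assms(1) interior_subset by blast
  then have "(f \<longlongrightarrow> f x) (at x within cbox a b)"
    using False by (simp add: discontinuities_on_def continuous_within)
  then show ?thesis using tendsto_within_subset directional_part_subset[OF x] by blast
qed

section \<open>Sufficiency: local oscillation, compactness, approximation\<close>

text \<open>On each directional part, \<open>f\<close> stays within \<open>e / 2\<close> of its
  limit near \<open>x\<close>. As there are finitely many directions, one open box around
  \<open>x\<close> works for all of them, and its intersections with the parts are bricks of
  oscillation less than \<open>e\<close>.\<close>

lemma local_small_oscillation: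
  fixes x :: "real ^ 'n"
  assumes "x \<in> interior (cbox a b)" "x \<notin> dis2 a b f" "0 < e"
  shows "\<exists>U \<P>. open U \<and> x \<in> U \<and> finite \<P> \<and> (\<forall>P\<in>\<P>. brick P \<and> P \<subseteq> cbox a b) \<and> U \<subseteq> \<Union>\<P> \<and>
      (\<forall>P\<in>\<P>. \<forall>y\<in>P. \<forall>z\<in>P. \<bar>f y - f z\<bar> < e)"
proof -
  have xb: "x \<in> box a b" using assms(1) by (simp add: interior_cbox)
  have xc: "x \<in> cbox a b" using assms(1) interior_subset by blast
  let ?D = "directional_part a b x"
  have "\<exists>S L. open S \<and> x \<in> S \<and> (\<forall>y\<in>S \<inter> ?D \<alpha>. \<bar>f y - L\<bar> < e / 2)" if \<alpha>: "\<alpha> \<in> directions" for \<alpha>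
  proof -
    obtain L where "(f \<longlongrightarrow> L) (at x within ?D \<alpha>)"
      using directional_limit_exists[OF assms(1,2) \<alpha>] by blast
    then have "\<forall>\<^sub>F y in at x within ?D \<alpha>. dist (f y) L < e / 2"
      using assms(3) by (intro tendstoD) auto
    then show ?thesis
      using center_notin_directional_part[OF \<alpha>, of x a b]
      unfolding eventually_at_topological dist_real_def by (metis IntE)
  qed
  then obtain S L where SL: "\<And>\<alpha>. \<alpha> \<in> directions \<Longrightarrow> open (S \<alpha>) \<and> x \<in> S \<alpha> \<and> (\<forall>y\<in>S \<alpha> \<inter> ?D \<alpha>. \<bar>f y - L \<alpha>\<bar> < e / 2)"
    by metis
  define V where "V = box a b \<inter> (\<Inter>\<alpha>\<in>directions. S \<alpha>)"
  have "open V" "x \<in> V"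
    unfolding V_def using SL xb finite_directions by (auto intro!: open_Int open_INT)
  then obtain l u where lu: "x \<in> box l u" "box l u \<subseteq> V"
    using open_contains_box[of V x] by (metis (no_types))
  have brick: "brick (box l u)"
    using lu(1) by (intro brick_box) (auto simp: mem_box_cart intro: less_trans)
  \<comment> \<open>The singleton is a piece of its own since \<open>f x\<close> may differ from all
    directional limits. The empty set is removed because it is not a brick.\<close>
  define \<P> where "\<P> = insert {x} ((\<lambda>\<alpha>. ?D \<alpha> \<inter> box l u) ` directions - {{}})"
  have "brick {x}" using brick_cbox(1)[of x x] by simp
  have bP: "brick P \<and> P \<subseteq> cbox a b" if "P \<in> \<P>" for P
    using that \<open>brick {x}\<close> xc directional_part_subset[OF xc] brick brick_directional_part[OF xb]
    by (auto simp: \<P>_def intro!: brick_Int)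
  have cover: "box l u \<subseteq> \<Union>\<P>"
  proof
    fix y assume y: "y \<in> box l u"
    then have yc: "y \<in> cbox a b" using lu(2) box_subset_cbox unfolding V_def by blast
    show "y \<in> \<Union>\<P>"
    proof (cases "y = x")
      case False
      then obtain \<alpha> where "\<alpha> \<in> directions" "y \<in> ?D \<alpha>"
        using cbox_directional_parts[OF xc yc] by metis
      then show ?thesis using y by (auto simp: \<P>_def)
    qed (simp add: \<P>_def)
  qed
  have osc: "\<bar>f y - f z\<bar> < e" if P: "P \<in> \<P>" "y \<in> P" "z \<in> P" for P y z
  proof (cases "P = {x}")
    case True
    then show ?thesis using that assms(3) by auto
  next
    case False
    then obtain \<alpha> where \<alpha>: "\<alpha> \<in> directions" "P = ?D \<alpha> \<inter> box l u" using P(1) unfolding \<P>_def by blast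
    then have "y \<in> S \<alpha> \<inter> ?D \<alpha>" "z \<in> S \<alpha> \<inter> ?D \<alpha>" using P lu(2) by (auto simp: V_def)
    then have "\<bar>f y - L \<alpha>\<bar> < e / 2" "\<bar>f z - L \<alpha>\<bar> < e / 2" using SL \<alpha>(1) by blast+
    then show ?thesis by linarith
  qed
  show ?thesis
    using lu(1) bP cover osc finite_directions
    by (intro exI[of _ "box l u"] exI[of _ \<P>]) (auto simp: \<P>_def)
qed

text \<open>Removing the open set \<open>W\<close> from the closed box leaves a compact set of
  interior points outside \<open>dis2\<close>, so finitely many of the local neighbourhoods cover
  it.\<close>

lemma step_approximation:
  fixes a b :: "real ^ 'n"
  assumes "open W" "dis2 a b f \<subseteq> W" "cbox a b - interior (cbox a b) \<subseteq> W"
    and bound: "\<And>x. x \<in> cbox a b - W \<Longrightarrow> \<bar>f x\<bar> \<le> C" and "0 \<le> C" "0 < e"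
  shows "\<exists>g. step_function_on (cbox a b) g \<and> (\<forall>x\<in>cbox a b. \<bar>g x\<bar> \<le> C) \<and>
     (\<forall>x\<in>cbox a b - W. \<bar>g x - f x\<bar> < e)"
proof -
  let ?T = "cbox a b" and ?K = "cbox a b - W"
  have "\<exists>U \<P>. open U \<and> x \<in> U \<and> finite \<P> \<and> (\<forall>P\<in>\<P>. brick P \<and> P \<subseteq> ?T) \<and> U \<subseteq> \<Union>\<P> \<and>
      (\<forall>P\<in>\<P>. \<forall>y\<in>P. \<forall>z\<in>P. \<bar>f y - f z\<bar> < e)" if "x \<in> ?K" for x
    using that assms(2,3,6) by (intro local_small_oscillation) auto
  then obtain U \<P> where UP: "\<And>x. x \<in> ?K \<Longrightarrow> open (U x) \<and> x \<in> U x \<and> finite (\<P> x) \<and>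
      (\<forall>P\<in>\<P> x. brick P \<and> P \<subseteq> ?T) \<and> U x \<subseteq> \<Union>(\<P> x) \<and> (\<forall>P\<in>\<P> x. \<forall>y\<in>P. \<forall>z\<in>P. \<bar>f y - f z\<bar> < e)"
    by metis
  have "compact ?K" using assms(1) by (intro compact_diff compact_cbox)
  then obtain X where X: "X \<subseteq> ?K" "finite X" "?K \<subseteq> (\<Union>x\<in>X. U x)"
    by (rule compactE_image[of ?K ?K U]) (use UP in auto)
  define \<Q> where "\<Q> = (\<Union>x\<in>X. \<P> x)"
  \<comment> \<open>The value of a piece is sampled off \<open>W\<close>, the only region where
    \<open>f\<close> is known to be bounded by \<open>C\<close>. A piece inside \<open>W\<close>
    gets the default 0, which respects the bound since \<open>0 \<le> C\<close>.\<close>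
  define v where "v P = (if P - W = {} then 0 else f (SOME y. y \<in> P - W))" for P
  have pick: "\<exists>y\<in>P - W. v P = f y" if "P - W \<noteq> {}" for P
    using that some_in_eq[of "P - W"] unfolding v_def by metis
  have UX: "U x \<subseteq> \<Union>(\<P> x)" "finite (\<P> x)" if "x \<in> X" for x
    using UP[of x] X(1) that by auto
  have Q1: "finite \<Q>" using X(2) UX(2) by (auto simp: \<Q>_def)
  have Q2: "\<exists>P\<in>\<Q>. y \<in> P" if y: "y \<in> ?K" for y
  proof -
    obtain x where "x \<in> X" "y \<in> U x" using X(3) y by auto
    then obtain P where "P \<in> \<P> x" "y \<in> P" using UX(1) by blast
    then show ?thesis using \<open>x \<in> X\<close> by (auto simp: \<Q>_def)
  qed
  have QP: "brick P \<and> P \<subseteq> ?T \<and> (\<forall>y\<in>P. \<forall>z\<in>P. \<bar>f y - f z\<bar> < e)" if P: "P \<in> \<Q>" for P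
  proof -
    obtain x where "x \<in> X" "P \<in> \<P> x" using P by (auto simp: \<Q>_def)
    moreover have "x \<in> ?K" using X(1) \<open>x \<in> X\<close> by blast
    ultimately show ?thesis using UP by blast
  qed
  have "\<bar>v P\<bar> \<le> C" if "P \<in> \<Q>" for P
  proof (cases "P - W = {}")
    case True
    then show ?thesis using assms(5) by (simp add: v_def)
  next
    case False
    then show ?thesis using pick[OF False] bound QP[OF that] by auto
  qed
  then obtain g where g: "step_function_on ?T g" "\<forall>x\<in>?T. \<bar>g x\<bar> \<le> C" "\<forall>x\<in>\<Union>\<Q>. \<exists>P\<in>\<Q>. x \<in> P \<and> g x = v P"
    using step_function_on_pieces[of \<Q> ?T v C] Q1 QP assms(5) by auto
  have "\<bar>g x - f x\<bar> < e" if x: "x \<in> ?K" for x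
  proof -
    obtain P where P: "P \<in> \<Q>" "x \<in> P" "g x = v P" using g(3) Q2[OF x] by blast
    \<comment> \<open>The point \<open>x\<close> lies in \<open>P - W\<close>, so \<open>v P\<close>
      is a sampled value and not the default.\<close>
    then obtain y where "y \<in> P" "v P = f y" using pick[of P] x by auto
    then show ?thesis using QP[OF P(1)] P by auto
  qed
  then show ?thesis using g by blast
qed

lemma K_integrable_if:
  fixes a b :: "real ^ 'n"
  assumes ab: "\<And>k. a $ k \<le> b $ k" and N: "jordan_null N" "bounded (f ` (cbox a b - N))"
    and dis: "jordan_null (dis2 a b f)"
  shows "K_integrable_on f (cbox a b)"
proof -
  let ?T = "cbox a b"
  \<comment> \<open>One Jordan null set collecting the points where the bound may fail, where
    directional limits may fail, and where they are not considered at all.\<close>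
  define Z where "Z = N \<union> dis2 a b f \<union> (?T - interior ?T)"
  have Z: "jordan_null Z"
    unfolding Z_def using N(1) dis jordan_null_boundary_cbox[OF ab] by (intro jordan_null_Un)
  obtain C where C: "0 < C" "\<And>x. x \<in> ?T - N \<Longrightarrow> \<bar>f x\<bar> \<le> C"
    using N(2) unfolding bounded_pos by auto
  have "\<exists>\<U>. finite \<U> \<and> (\<forall>U\<in>\<U>. brick U \<and> open U) \<and> Z \<subseteq> \<Union>\<U> \<and> (\<Sum>U\<in>\<U>. brick_volume U) < inverse (Suc m)" for m
    using jordan_null_open_cover[OF Z, of "inverse (Suc m)"] by (metis inverse_positive_iff_positive of_nat_0_less_iff zero_less_Suc)
  then obtain \<U> where \<U>: "\<And>m. finite (\<U> m)" "\<And>m. \<forall>U\<in>\<U> m. brick U \<and> open U" "\<And>m. Z \<subseteq> \<Union>(\<U> m)"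
      "\<And>m. (\<Sum>U\<in>\<U> m. brick_volume U) < inverse (Suc m)"
    by metis
  \<comment> \<open>Decreasing in \<open>m\<close>, so that the single cover \<open>\<U> M\<close> contains the exceptional sets of all \<open>m \<ge> M\<close>.\<close>
  define W where "W m = (\<Inter>j\<in>{..m}. \<Union>(\<U> j))" for m :: nat
  have "\<exists>g. step_function_on ?T g \<and> (\<forall>x\<in>?T. \<bar>g x\<bar> \<le> C) \<and> (\<forall>x\<in>?T - W m. \<bar>g x - f x\<bar> < inverse (Suc m))" for m
  proof (rule step_approximation)
    show "open (W m)" unfolding W_def using \<U>(2) by (intro open_INT) auto
    have ZW: "Z \<subseteq> W m" unfolding W_def using \<U>(3) by blast
    show "dis2 a b f \<subseteq> W m" "?T - interior ?T \<subseteq> W m"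
      using ZW unfolding Z_def by blast+
    show "\<bar>f x\<bar> \<le> C" if "x \<in> ?T - W m" for x
      using that ZW unfolding Z_def by (intro C(2)) auto
  qed (use C in auto)
  then obtain g where g: "\<And>m. step_function_on ?T (g m)" "\<And>m. \<forall>x\<in>?T. \<bar>g m x\<bar> \<le> C"
      "\<And>m. \<forall>x\<in>?T - W m. \<bar>g m x - f x\<bar> < inverse (Suc m)"
    by metis
  have "converges_nearly_uniformly ?T g f"
    unfolding converges_nearly_uniformly_def
  proof (intro conjI allI impI)
    show "\<exists>C. \<forall>m. \<forall>x\<in>?T. \<bar>g m x\<bar> \<le> C" using g(2) by blast
    fix \<delta> :: real assume "0 < \<delta>"
    then obtain M where M: "inverse (Suc M) < \<delta>" using reals_Archimedean by blast
    \<comment> \<open>Nearly uniform convergence asks for bricks inside \<open>T\<close>: those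
      missing \<open>T\<close> are dropped, the others are cut down to it.\<close>
    define \<V> where "\<V> = {U \<in> \<U> M. U \<inter> ?T \<noteq> {}}"
    define \<B> where "\<B> = (\<lambda>U. U \<inter> ?T) ` \<V>"
    have bT: "brick ?T" using ab by (rule brick_cbox)
    have \<V>: "finite \<V>" "\<And>U. U \<in> \<V> \<Longrightarrow> brick U \<and> brick (U \<inter> ?T)" 
      using \<U>(1,2) bT by (auto simp: \<V>_def intro!: brick_Int)
    have "(\<Sum>B\<in>\<B>. brick_volume B) \<le> (\<Sum>B\<in>\<V>. brick_volume B) + card \<V> * (0 :: real)"
      unfolding \<B>_def using \<V> by (intro sum_brick_volume_image_le) (auto intro: brick_volume_mono)
    also have "\<dots> \<le> (\<Sum>B\<in>\<U> M. brick_volume B)"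
      using \<U>(1,2) by (auto simp: \<V>_def intro!: sum_mono2 brick_volume_nonneg)
    also have "\<dots> < \<delta>" using \<U>(4)[of M] M by simp
    finally have vol: "(\<Sum>B\<in>\<B>. brick_volume B) < \<delta>" .
    have sub: "?T - \<Union>\<B> \<subseteq> ?T - W m" if "M \<le> m" for m
      using that by (auto simp: \<B>_def \<V>_def W_def)
    have "uniform_limit (?T - \<Union>\<B>) g f sequentially"
    proof (rule uniform_limitI)
      fix e :: real assume "0 < e"
      \<comment> \<open>From \<open>M\<close> on, \<open>W m\<close> meets \<open>T\<close> only
        inside the fixed cover; from \<open>K\<close> on, the approximation error is below
        \<open>e\<close>.\<close>
      then obtain K where K: "inverse (Suc K) < e" using reals_Archimedean by blast
      show "\<forall>\<^sub>F m in sequentially. \<forall>x\<in>?T - \<Union>\<B>. dist (g m x) (f x) < e"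
        using eventually_ge_at_top[of "max M K"]
      proof eventually_elim
        case (elim m)
        have "inverse (real (Suc m)) \<le> inverse (Suc K)" using elim by (intro le_imp_inverse_le) auto
        then have "inverse (real (Suc m)) < e" using K by linarith
        then show ?case using g(3)[of m] sub[of m] elim by (auto simp: dist_real_def intro: less_trans)
      qed
    qed
    then show "\<exists>\<B>. finite \<B> \<and> (\<forall>B\<in>\<B>. brick B \<and> B \<subseteq> ?T) \<and> (\<Sum>B\<in>\<B>. brick_volume B) < \<delta> \<and>
          uniform_limit (?T - \<Union>\<B>) g f sequentially"
      using vol \<V> by (intro exI[of _ \<B>]) (auto simp: \<B>_def)
  qed
  then show ?thesis unfolding K_integrable_on_def using g(1) by blast
qed

section \<open>Directional limits and continuity of step functions\<close>

text \<open>Either \<open>I\<close> has points arbitrarily close to \<open>t\<close> on the left,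
  and by convexity contains a whole left neighbourhood, or it misses one. In both cases the
  indicator is eventually constant.\<close>

lemma indicator_interval_at_left:
  fixes I :: "real set"
  assumes "is_interval I"
  shows "\<exists>c::real. (indicator I \<longlongrightarrow> c) (at_left t)"
proof (cases "\<forall>s<t. \<exists>r\<in>I. s < r \<and> r < t")
  case True
  then obtain r0 where r0: "r0 \<in> I" "r0 < t" by (meson lt_ex)
  have "s \<in> I" if "r0 < s" "s < t" for s
    using True that r0(1) assms unfolding is_interval_1 by (meson less_imp_le)
  then have "\<forall>\<^sub>F s in at_left t. indicator I s = (1::real)"
    unfolding eventually_at_left[OF r0(2)] using r0(2) by (intro exI[of _ r0]) auto
  then show ?thesis using tendsto_eventually by blast
next
  case False
  then obtain s where s: "s < t" "\<forall>r\<in>I. \<not> (s < r \<and> r < t)" by blast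
  then have "\<forall>\<^sub>F s in at_left t. indicator I s = (0::real)"
    unfolding eventually_at_left[OF s(1)] by (intro exI[of _ s]) (auto simp: indicator_def)
  then show ?thesis using tendsto_eventually by blast
qed

text \<open>Reflection at 0 turns right limits into left limits and intervals into
  intervals.\<close>

lemma indicator_interval_at_right:
  fixes I :: "real set"
  assumes "is_interval I"
  shows "\<exists>c::real. (indicator I \<longlongrightarrow> c) (at_right t)"
proof -
  have "is_interval (uminus ` I)" using assms by simp
  then obtain c :: real where "(indicator (uminus ` I) \<longlongrightarrow> c) (at_left (- t))"
    using indicator_interval_at_left by blast
  then have "((\<lambda>s. indicator (uminus ` I) (- s)) \<longlongrightarrow> c) (at_right t)"
    by (subst (asm) at_left_minus) (simp add: filterlim_filtermap)
  moreover have "(\<lambda>s. indicator (uminus ` I) (- s)) = (indicator I :: real \<Rightarrow> real)"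
    by (auto simp: indicator_def fun_eq_iff)
  ultimately show ?thesis by auto
qed

text \<open>The indicator of a brick is the product of the indicators of its factors. Along a
  directional part each coordinate tends to its limit from the left, from the right, or is constant,
  so every factor has a limit.\<close>

lemma brick_indicator_directional_limit:
  fixes x :: "real ^ 'n"
  assumes "brick B"
  shows "\<exists>c::real. (indicator B \<longlongrightarrow> c) (at x within directional_part a b x \<alpha>)"
proof -
  obtain I where I: "\<And>k. is_interval (I k)" and B: "B = {x. \<forall>k. x $ k \<in> I k}"
    using assms by (rule brickE) (rule that; assumption)
  let ?D = "directional_part a b x \<alpha>"
  have lim: "((\<lambda>y. y $ k) \<longlongrightarrow> x $ k) (at x within ?D)" for k
    by (intro tendsto_intros)
  have D: "\<forall>\<^sub>F y in at x within ?D. y \<in> ?D" by (simp add: eventually_at_filter)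
  have mem: "y $ k \<in> (if \<alpha> $ k = -1 then {a $ k..<x $ k} else if \<alpha> $ k = 0 then {x $ k} else {x $ k<..b $ k})"
    if "y \<in> ?D" for y k
    using that unfolding directional_part_def by blast
  have "\<exists>c::real. ((\<lambda>y. indicator (I k) (y $ k)) \<longlongrightarrow> c) (at x within ?D)" for k
  proof (cases "\<alpha> $ k = -1 \<or> \<alpha> $ k = 0")
    \<comment> \<open>Every value other than -1 and 0 falls under the right-hand branch of
      \<open>directional_part\<close>.\<close>
    case False
    have "\<forall>\<^sub>F y in at x within ?D. y $ k > x $ k"
      using D by eventually_elim (drule mem[where k = k], use False in auto)
    then have "filterlim (\<lambda>y. y $ k) (at_right (x $ k)) (at x within ?D)"
      using lim by (simp add: filterlim_at eventually_conj_iff eventually_mono)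
    then show ?thesis using indicator_interval_at_right[OF I, of k "x $ k"] filterlim_compose by blast
  next
    case True
    then show ?thesis
    proof
      assume \<alpha>: "\<alpha> $ k = -1"
      have "\<forall>\<^sub>F y in at x within ?D. y $ k < x $ k"
        using D by eventually_elim (drule mem[where k = k], simp add: \<alpha>)
      then have "filterlim (\<lambda>y. y $ k) (at_left (x $ k)) (at x within ?D)"
        using lim by (simp add: filterlim_at eventually_conj_iff eventually_mono)
      then show ?thesis using indicator_interval_at_left[OF I, of k "x $ k"] filterlim_compose by blast
    next
      assume \<alpha>: "\<alpha> $ k = 0"
      have "\<forall>\<^sub>F y in at x within ?D. y $ k = x $ k"
        using D by eventually_elim (drule mem[where k = k], simp add: \<alpha>)
      then have "\<forall>\<^sub>F y in at x within ?D. indicator (I k) (y $ k) = (indicator (I k) (x $ k) :: real)"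
        by eventually_elim simp
      then show ?thesis by (intro exI) (rule tendsto_eventually)
    qed
  qed
  then obtain c where "\<And>k. ((\<lambda>y. indicator (I k) (y $ k) :: real) \<longlongrightarrow> c k) (at x within ?D)" by metis
  then have "((\<lambda>y. \<Prod>k\<in>UNIV. indicator (I k) (y $ k) :: real) \<longlongrightarrow> (\<Prod>k\<in>UNIV. c k)) (at x within ?D)"
    by (intro tendsto_prod) auto
  moreover have "(\<lambda>y. \<Prod>k\<in>UNIV. indicator (I k) (y $ k)) = (indicator B :: real ^ 'n \<Rightarrow> real)"
    by (auto simp: B fun_eq_iff indicator_def)
  ultimately show ?thesis by auto
qed

lemma step_function_directional_limit:
  fixes x :: "real ^ 'n"
  assumes "step_function_on (cbox a b) g" "x \<in> cbox a b"
  shows "\<exists>L. (g \<longlongrightarrow> L) (at x within directional_part a b x \<alpha>)"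
proof -
  let ?D = "directional_part a b x \<alpha>"
  obtain M :: nat and d B where g: "\<forall>j<M. brick (B j) \<and> B j \<subseteq> cbox a b"
    "\<forall>x\<in>cbox a b. g x = (\<Sum>j<M. d j * indicator (B j) x)"
    using assms(1) by (rule step_function_onE) (rule that; assumption)
  have "\<forall>j<M. \<exists>c::real. (indicator (B j) \<longlongrightarrow> c) (at x within ?D)"
    using g(1) brick_indicator_directional_limit by blast
  then obtain c where c: "\<And>j. j < M \<Longrightarrow> ((\<lambda>y. indicator (B j) y :: real) \<longlongrightarrow> c j) (at x within ?D)" by metis
  have "((\<lambda>y. \<Sum>j<M. d j * indicator (B j) y) \<longlongrightarrow> (\<Sum>j<M. d j * c j)) (at x within ?D)"
    using c by (intro tendsto_sum tendsto_mult tendsto_const) auto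
  moreover have "\<forall>\<^sub>F y in at x within ?D. (\<Sum>j<M. d j * indicator (B j) y) = g y"
    using directional_part_subset[OF assms(2)] g(2) by (auto simp: eventually_at_filter subset_iff)
  ultimately show ?thesis using Lim_transform_eventually by blast
qed

text \<open>The indicator of a brick is continuous off its frontier. The frontier lies between the
  open and the closed box with the same corners, hence on the hyperplanes through the faces.\<close>

lemma step_function_continuous_off_hyperplanes:
  fixes T :: "(real ^ 'n) set"
  assumes "step_function_on T g"
  shows "\<exists>\<H>. finite \<H> \<and> (\<forall>H\<in>\<H>. coordinate_hyperplane H) \<and> (\<forall>x\<in>T - \<Union>\<H>. continuous (at x within T) g)"
proof -
  obtain M :: nat and d B where g: "\<forall>j<M. brick (B j) \<and> B j \<subseteq> T"
    "\<forall>x\<in>T. g x = (\<Sum>j<M. d j * indicator (B j) x)"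
    using assms(1) by (rule step_function_onE) (rule that; assumption)
  have "\<forall>j<M. \<exists>l u. box l u \<subseteq> B j \<and> B j \<subseteq> cbox l u"
    using g(1) brick_between_boxes by metis
  then obtain l u where lu: "\<And>j. j < M \<Longrightarrow> box (l j) (u j) \<subseteq> B j \<and> B j \<subseteq> cbox (l j) (u j)" by metis
  define \<H> where "\<H> = (\<Union>j<M. \<Union>k. {{x :: real ^ 'n. x $ k = l j $ k}, {x. x $ k = u j $ k}})"
  have "continuous (at x within T) g" if x: "x \<in> T" "x \<notin> \<Union>\<H>" for x
  proof -
    have "isCont (indicator (B j) :: _ \<Rightarrow> real) x" if j: "j < M" for j
    proof -
      have "frontier (B j) \<subseteq> cbox (l j) (u j) - box (l j) (u j)"
        unfolding frontier_def using lu[OF j] closure_minimal[of "B j" "cbox (l j) (u j)"]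
          interior_maximal[of "box (l j) (u j)" "B j"] by (auto simp: open_box)
      moreover have "x $ k \<noteq> l j $ k \<and> x $ k \<noteq> u j $ k" for k
        using x(2) j unfolding \<H>_def by blast
      then have "x \<notin> cbox (l j) (u j) - box (l j) (u j)"
        by (auto simp: mem_box_cart order_less_le) metis
      ultimately show ?thesis using isCont_indicator by blast
    qed
    then have "isCont (\<lambda>y. \<Sum>j<M. d j * indicator (B j) y) x"
      by (intro continuous_intros) auto
    then have "continuous (at x within T) (\<lambda>y. \<Sum>j<M. d j * indicator (B j) y)"
      by (rule continuous_at_imp_continuous_at_within)
    then show ?thesis
      by (rule continuous_transform_within[OF _ zero_less_one x(1)]) (use g(2) in auto)
  qed
  moreover have "finite \<H>" "\<forall>H\<in>\<H>. coordinate_hyperplane H"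
    unfolding \<H>_def coordinate_hyperplane_def by auto
  ultimately show ?thesis by blast
qed

section \<open>Necessity: properties inherited by nearly uniform limits\<close>

text \<open>Each brick is replaced by an enclosing closed box of the same volume. With
  \<open>E\<close> closed, a point off \<open>E\<close> has a neighbourhood in which convergence on
  \<open>T\<close> is uniform, so local arguments apply there.\<close>

lemma nearly_uniform_closed_exceptional:
  fixes T :: "(real ^ 'n) set"
  assumes "converges_nearly_uniformly T g f" "0 < \<delta>"
  obtains E \<B> where "closed E" "uniform_limit (T - E) g f sequentially"
    "finite \<B>" "\<And>B. B \<in> \<B> \<Longrightarrow> brick B" "E = \<Union>\<B>" "(\<Sum>B\<in>\<B>. brick_volume B) < \<delta>"
proof -
  obtain \<B> where \<B>: "finite \<B>" "\<And>B. B \<in> \<B> \<Longrightarrow> brick B" "(\<Sum>B\<in>\<B>. brick_volume B) < \<delta>"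
      "uniform_limit (T - \<Union>\<B>) g f sequentially"
    using assms unfolding converges_nearly_uniformly_def by metis
  have "\<exists>D. closed D \<and> brick D \<and> B \<subseteq> D \<and> brick_volume D = brick_volume B" if B: "B \<in> \<B>" for B
    using brick_between_boxes[OF \<B>(2)[OF B]] brick_cbox closed_cbox by metis
  then obtain h where h: "\<And>B. B \<in> \<B> \<Longrightarrow> closed (h B) \<and> brick (h B) \<and> B \<subseteq> h B \<and> brick_volume (h B) = brick_volume B"
    by metis
  show thesis
  proof (rule that)
    show "closed (\<Union>(h ` \<B>))" using \<B>(1) h by blast
    show "uniform_limit (T - \<Union>(h ` \<B>)) g f sequentially"
      by (rule uniform_limit_on_subset[OF \<B>(4)]) (use h in blast)
    show "finite (h ` \<B>)" using \<B>(1) by simp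
    show "brick B" if "B \<in> h ` \<B>" for B using that h by blast
    show "(\<Sum>B\<in>h ` \<B>. brick_volume B) < \<delta>"
      using sum_brick_volume_image_le[of \<B> h 0] \<B> h by simp
  qed simp
qed

text \<open>The common scheme of the necessity proofs: the bricks making up \<open>E\<close> cover
  \<open>S\<close> and have arbitrarily small total volume. It remains to show, for a single
  \<open>E\<close>, that no point off \<open>E\<close> is bad.\<close>

lemma jordan_null_exceptional:
  fixes T :: "(real ^ 'n) set"
  assumes "converges_nearly_uniformly T g f"
    and "\<And>E x. closed E \<Longrightarrow> uniform_limit (T - E) g f sequentially \<Longrightarrow> x \<in> S \<Longrightarrow> x \<in> E"
  shows "jordan_null S"
  unfolding jordan_null_def
proof (intro allI impI)
  fix \<epsilon> :: real assume "0 < \<epsilon>"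
  then obtain E \<B> where "closed E" "uniform_limit (T - E) g f sequentially"
    "finite \<B>" "\<And>B. B \<in> \<B> \<Longrightarrow> brick B" "E = \<Union>\<B>" "(\<Sum>B\<in>\<B>. brick_volume B) < \<epsilon>"
    using nearly_uniform_closed_exceptional[OF assms(1)] by metis
  then show "\<exists>\<B>. finite \<B> \<and> (\<forall>B\<in>\<B>. brick B) \<and> S \<subseteq> \<Union>\<B> \<and> (\<Sum>B\<in>\<B>. brick_volume B) < \<epsilon>"
    using assms(2) by (intro exI[of _ \<B>]) blast
qed

text \<open>Off \<open>E\<close> there is pointwise convergence, so the common bound of the
  \<open>g m\<close> passes to \<open>f\<close>. Thus \<open>N\<close> can be the set where
  \<open>f\<close> exceeds this bound.\<close>

lemma nearly_uniform_limit_bounded: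
  fixes T :: "(real ^ 'n) set"
  assumes "converges_nearly_uniformly T g f"
  shows "\<exists>N. jordan_null N \<and> bounded (f ` (T - N))"
proof -
  obtain C where C: "\<And>m x. x \<in> T \<Longrightarrow> \<bar>g m x\<bar> \<le> C"
    using assms unfolding converges_nearly_uniformly_def by blast
  have "jordan_null {x \<in> T. C < \<bar>f x\<bar>}"
  proof (rule jordan_null_exceptional[OF assms], rule ccontr)
    fix E x assume E: "uniform_limit (T - E) g f sequentially" and x: "x \<in> {x \<in> T. C < \<bar>f x\<bar>}" "x \<notin> E"
    have "(\<lambda>m. g m x) \<longlonglongrightarrow> f x" using tendsto_uniform_limitI[OF E] x by auto
    then have "\<bar>f x\<bar> \<le> C"
      using C x by (intro tendsto_upperbound[OF tendsto_rabs]) auto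
    then show False using x by simp
  qed
  moreover have "bounded (f ` (T - {x \<in> T. C < \<bar>f x\<bar>}))"
    unfolding bounded_iff by (intro exI[of _ C]) auto
  ultimately show ?thesis by blast
qed

text \<open>Off \<open>E\<close>, a single \<open>g m\<close> uniformly close to \<open>f\<close>
  has a directional limit, which confines \<open>f\<close> near \<open>x\<close> to a small
  interval. Completeness of the reals then yields a limit of \<open>f\<close>.\<close>

lemma nearly_uniform_limit_dis2:
  fixes a b :: "real ^ 'n"
  assumes "converges_nearly_uniformly (cbox a b) g f" and step: "\<And>m. step_function_on (cbox a b) (g m)"
  shows "jordan_null (dis2 a b f)"
proof (rule jordan_null_exceptional[OF assms(1)], rule ccontr)
  fix E x assume E: "closed E" "uniform_limit (cbox a b - E) g f sequentially" and x: "x \<in> dis2 a b f" "x \<notin> E"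
  have xi: "x \<in> interior (cbox a b)" using x(1) by (simp add: dis2_def)
  then have xT: "x \<in> cbox a b" using interior_subset by blast
  have "\<exists>L. (f \<longlongrightarrow> L) (at x within directional_part a b x \<alpha>)" for \<alpha>
  proof -
    let ?F = "at x within directional_part a b x \<alpha>"
    \<comment> \<open>The Cauchy property avoids following the limits of the \<open>g m\<close> as
      \<open>m\<close> grows. Two errors of \<open>e / 4\<close> put \<open>f\<close> within
      \<open>e / 2\<close> of \<open>L\<close>, and two such values within \<open>e\<close> of each
      other.\<close>
    have "cauchy_filter (filtermap f ?F)"
      unfolding cauchy_filter_metric_filtermap
    proof (intro allI impI)
      fix e :: real assume "0 < e"
      then have ev: "\<forall>\<^sub>F m in sequentially. \<forall>y\<in>cbox a b - E. dist (g m y) (f y) < e / 4"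
        using E(2) by (intro uniform_limitD) auto
      obtain m where m: "\<forall>y\<in>cbox a b - E. dist (g m y) (f y) < e / 4"
        using eventually_happens'[OF sequentially_bot ev] by (rule exE)
      obtain L where "(g m \<longlongrightarrow> L) ?F" using step_function_directional_limit[OF step xT] by blast
      then have "\<forall>\<^sub>F y in ?F. dist (g m y) L < e / 4" using \<open>0 < e\<close> by (intro tendstoD) auto
      moreover have "\<forall>\<^sub>F y in ?F. y \<in> - E"
        using E(1) x(2) by (intro topological_tendstoD[OF tendsto_ident_at]) auto
      moreover have "\<forall>\<^sub>F y in ?F. y \<in> cbox a b"
        using directional_part_subset[OF xT] by (auto simp: eventually_at_filter subset_iff)
      ultimately have "\<forall>\<^sub>F y in ?F. dist (f y) L < e / 2"
      proof eventually_elim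
        case (elim y)
        then show ?case using m[rule_format, of y] dist_triangle3[of "f y" L "g m y"] by simp
      qed
      then show "\<exists>P. eventually P ?F \<and> (\<forall>y z. P y \<and> P z \<longrightarrow> dist (f y) (f z) < e)"
        by (intro exI[of _ "\<lambda>y. dist (f y) L < e / 2"]) (auto intro: dist_triangle_half_l)
    qed
    then show ?thesis
    proof (cases "?F = bot")
      \<comment> \<open>Completeness needs a proper filter. The filter is trivial for example when
        \<open>\<alpha> = 0\<close>, where the directional part is \<open>{x}\<close>; then any
        limit will do.\<close>
      case False
      then have "\<exists>L. filtermap f ?F \<le> nhds L"
        using \<open>cauchy_filter (filtermap f ?F)\<close> complete_UNIV[where 'a=real]
        by (auto simp: complete_uniform filtermap_bot_iff)
      then show ?thesis by (simp add: filterlim_def)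
    qed simp
  qed
  then show False using x(1) unfolding dis2_def dis1_def by blast
qed

text \<open>The finite hyperplane families of all the \<open>g m\<close> form one countable family.
  Away from it every \<open>g m\<close> is continuous, and so is \<open>f\<close> at points off
  \<open>E\<close>; hence the discontinuities that it misses form a Jordan null set.\<close>

lemma nearly_uniform_limit_discontinuities:
  fixes T :: "(real ^ 'n) set"
  assumes "converges_nearly_uniformly T g f" and step: "\<And>m. step_function_on T (g m)"
  shows "\<exists>N \<H>. jordan_null N \<and> countable \<H> \<and> (\<forall>H\<in>\<H>. coordinate_hyperplane H) \<and>
                discontinuities_on f T \<subseteq> N \<union> \<Union>\<H>"
proof -
  obtain \<H> where \<H>: "\<And>m. finite (\<H> m)" "\<And>m. \<forall>H\<in>\<H> m. coordinate_hyperplane H"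
      "\<And>m. \<forall>x\<in>T - \<Union>(\<H> m). continuous (at x within T) (g m)"
    using step_function_continuous_off_hyperplanes[OF step] by metis
  let ?H = "\<Union>m. \<H> m"
  have "jordan_null (discontinuities_on f T - \<Union>?H)"
  proof (rule jordan_null_exceptional[OF assms(1)], rule ccontr)
    fix E x assume E: "closed E" "uniform_limit (T - E) g f sequentially"
      and x: "x \<in> discontinuities_on f T - \<Union>?H" "x \<notin> E"
    have xT: "x \<in> T" using x(1) by (simp add: discontinuities_on_def)
    have "(g m \<longlongrightarrow> g m x) (at x within T - E)" for m
      using \<H>(3)[of m] x(1) xT tendsto_within_subset by (auto simp: continuous_within intro: tendsto_within_subset)
    moreover have "(\<lambda>m. g m x) \<longlonglongrightarrow> f x" using tendsto_uniform_limitI[OF E(2)] x xT by auto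
    \<comment> \<open>Uniform convergence allows the limit in \<open>m\<close> and the limit at
      \<open>x\<close> to be interchanged.\<close>
    ultimately have "(f \<longlongrightarrow> f x) (at x within T - E)"
      using E(2) by (intro swap_uniform_limit[where f = g and F = sequentially and g = "\<lambda>m. g m x"]) auto
    \<comment> \<open>Closedness of \<open>E\<close> is used here: near \<open>x\<close> the sets
      \<open>T - E\<close> and \<open>T\<close> coincide.\<close>
    moreover have "at x within T - E = at x within T"
      using E(1) x(2) by (intro at_within_nhd[of x "- E"]) auto
    ultimately show False using x(1) by (simp add: discontinuities_on_def continuous_within)
  qed
  moreover have "countable ?H" using \<H>(1) by (simp add: countable_finite)
  ultimately show ?thesis using \<H>(2)
    by (intro exI[of _ "discontinuities_on f T - \<Union>?H"] exI[of _ ?H]) auto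
qed

section \<open>Continuity almost everywhere and the full characterization\<close>

lemma negligible_coordinate_hyperplane: "coordinate_hyperplane H \<Longrightarrow> negligible H"
  unfolding coordinate_hyperplane_def
  by (auto simp: cart_eq_inner_axis intro!: negligible_standard_hyperplane)

theorem theorem3p3:
  fixes a b :: "real ^ 'n" and f :: "real ^ 'n \<Rightarrow> real"
  assumes "\<forall>k. a $ k \<le> b $ k"
  shows "(K_integrable_on f (cbox a b) \<longleftrightarrow>
            (\<exists>N. jordan_null N \<and> bounded (f ` (cbox a b - N))) \<and> jordan_null (dis2 a b f))
       \<and> (K_integrable_on f (cbox a b) \<longrightarrow>
            (\<exists>N \<H>. jordan_null N \<and> countable \<H> \<and> (\<forall>H\<in>\<H>. coordinate_hyperplane H) \<and>
                discontinuities_on f (cbox a b) \<subseteq> N \<union> \<Union>\<H>)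
          \<and> (AE x in lebesgue. x \<in> cbox a b \<longrightarrow> continuous (at x within cbox a b) f))"
proof (intro conjI iffI impI)
  show "K_integrable_on f (cbox a b)"
    if "(\<exists>N. jordan_null N \<and> bounded (f ` (cbox a b - N))) \<and> jordan_null (dis2 a b f)"
    using that assms K_integrable_if by blast
  assume "K_integrable_on f (cbox a b)"
  then obtain g where g: "\<And>m. step_function_on (cbox a b) (g m)" "converges_nearly_uniformly (cbox a b) g f"
    unfolding K_integrable_on_def by blast
  show "\<exists>N. jordan_null N \<and> bounded (f ` (cbox a b - N))"
    using g(2) by (rule nearly_uniform_limit_bounded)
  show "jordan_null (dis2 a b f)"
    using g(2,1) by (rule nearly_uniform_limit_dis2)
  show ex: "\<exists>N \<H>. jordan_null N \<and> countable \<H> \<and> (\<forall>H\<in>\<H>. coordinate_hyperplane H) \<and>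
                discontinuities_on f (cbox a b) \<subseteq> N \<union> \<Union>\<H>"
    using g(2,1) by (rule nearly_uniform_limit_discontinuities)
  then obtain N \<H> where N: "jordan_null N" "countable \<H>" "\<forall>H\<in>\<H>. coordinate_hyperplane H"
      "discontinuities_on f (cbox a b) \<subseteq> N \<union> \<Union>\<H>" by blast
  have "negligible (N \<union> \<Union>\<H>)"
    using N jordan_null_imp_negligible negligible_coordinate_hyperplane
    by (intro negligible_Un negligible_countable_Union) auto
  then have "negligible (discontinuities_on f (cbox a b))"
    using N(4) negligible_subset by blast
  then have "AE x in lebesgue. x \<notin> discontinuities_on f (cbox a b)"
    by (simp add: negligible_iff_null_sets AE_not_in)
  then show "AE x in lebesgue. x \<in> cbox a b \<longrightarrow> continuous (at x within cbox a b) f"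
    by eventually_elim (auto simp: discontinuities_on_def)
qed

end
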